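(* Let $P$ and $Q$ be finite partially ordered sets, and let $I\subseteq\Bbbk[x_{Q\times P}]$ be an ideal generated by a subset of the generators $\prod_{q\in Q}x_{q,\phi(q)}$, $\phi\in\mathrm{Hom}(Q,P)$, of $L(Q,P)$. Then $I$ is inseparable.
   Context: $\Bbbk$ is a field. For a set $A$, $\Bbbk[x_A]$ is the polynomial ring in variables $x_a$, $a\in A$. $\mathrm{Hom}(Q,P)$ is the set of isotone (order preserving) maps $Q\to P$. $L(Q,P)\subseteq\Bbbk[x_{Q\times P}]$ is the ideal generated by the monomials $\prod_{q\in Q}x_{q,\phi(q)}$ for $\phi\in\mathrm{Hom}(Q,P)$. Separation: let $R'\to R$ be a surjective map of finite sets with $|R'|=|R|+1$, and let $r_1\neq r_2$ in $R'$ be the two elements mapping to the same element of $R$. Let $I$ be a monomial ideal in $\Bbbk[x_R]$. A monomial ideal $J$ in $\Bbbk[x_{R'}]$ is a separation of $I$ if (i) $I$ is the image of $J$ under the natural map $\Bbbk[x_{R'}]\to\Bbbk[x_R]$; (ii) $x_{r_1}$ occurs in some minimal generator of $J$, and so does $x_{r_2}$ (in some, possibly other, minimal generator); (iii) $x_{r_1}-x_{r_2}$ is a regular element (nonzerodivisor) of $\Bbbk[x_{R'}]/J$. The ideal $I$ is separable if it has some separation (for some such $R'\to R$), and inseparable otherwise. *)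

theory Defs
  imports "HOL-Library.Poly_Mapping" "HOL-Library.FuncSet" "HOL-Algebra.QuotRing"
begin

text \<open>A polynomial is a finitely supported map from exponent vectors to coefficients. The
  variables range over a whole type, and \<open>poly_ring A\<close> cuts out the polynomials in the
  variables \<open>x\<^sub>a\<close> with \<open>a \<in> A\<close>, so that \<open>A\<close> may be any set, including the empty one.\<close>

type_synonym ('a, 'k) mpoly = "('a \<Rightarrow>\<^sub>0 nat) \<Rightarrow>\<^sub>0 'k"

definition var :: "'a \<Rightarrow> ('a, 'k::field) mpoly" where
  "var a = Poly_Mapping.single (Poly_Mapping.single a 1) 1"

definition vars :: "('a, 'k::field) mpoly \<Rightarrow> 'a set" where
  "vars p = (\<Union>m \<in> Poly_Mapping.keys p. Poly_Mapping.keys m)"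

definition poly_ring :: "'a set \<Rightarrow> ('a, 'k::field) mpoly ring" where
  "poly_ring A = \<lparr>carrier = {p. vars p \<subseteq> A}, mult = (*), one = 1, zero = 0, add = (+)\<rparr>"

definition monomials :: "'a set \<Rightarrow> ('a, 'k::field) mpoly set" where
  "monomials A = {Poly_Mapping.single m 1 | m. Poly_Mapping.keys m \<subseteq> A}"

definition monomial_ideal :: "'a set \<Rightarrow> ('a, 'k::field) mpoly set \<Rightarrow> bool" where
  "monomial_ideal A J \<longleftrightarrow> (\<exists>G \<subseteq> monomials A. J = genideal (poly_ring A) G)"

text \<open>The minimal generators of a monomial ideal are the members of its minimal (in fact unique)
  generating set of monomials.\<close>

definition minimal_generating_set ::
    "'a set \<Rightarrow> ('a, 'k::field) mpoly set \<Rightarrow> ('a, 'k) mpoly set \<Rightarrow> bool" where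
  "minimal_generating_set A J G \<longleftrightarrow>
     G \<subseteq> monomials A \<and> J = genideal (poly_ring A) G \<and>
     (\<forall>G'. G' \<subset> G \<longrightarrow> genideal (poly_ring A) G' \<noteq> J)"

definition minimal_generator ::
    "'a set \<Rightarrow> ('a, 'k::field) mpoly set \<Rightarrow> ('a, 'k) mpoly \<Rightarrow> bool" where
  "minimal_generator A J g \<longleftrightarrow> (\<exists>G. minimal_generating_set A J G \<and> g \<in> G)"

definition regular_element :: "('a, 'b) ring_scheme \<Rightarrow> 'a \<Rightarrow> bool" where
  "regular_element S a \<longleftrightarrow>
     a \<in> carrier S \<and> (\<forall>b \<in> carrier S. a \<otimes>\<^bsub>S\<^esub> b = \<zero>\<^bsub>S\<^esub> \<longrightarrow> b = \<zero>\<^bsub>S\<^esub>)"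

text \<open>The homomorphism of \<open>\<Bbbk>\<close>-algebras sending \<open>x\<^sub>a\<close> to \<open>x\<^bsub>f a\<^esub>\<close>.\<close>

definition natural_map :: "('a \<Rightarrow> 'b) \<Rightarrow> ('a, 'k::field) mpoly \<Rightarrow> ('b, 'k) mpoly" where
  "natural_map f p =
     (\<Sum>m \<in> Poly_Mapping.keys p.
        Poly_Mapping.single 0 (Poly_Mapping.lookup p m) *
        (\<Prod>a \<in> Poly_Mapping.keys m. var (f a) ^ Poly_Mapping.lookup m a))"

definition separation ::
    "'s set \<Rightarrow> 'r set \<Rightarrow> ('s \<Rightarrow> 'r) \<Rightarrow> ('r, 'k::field) mpoly set \<Rightarrow> ('s, 'k) mpoly set \<Rightarrow> bool" where
  "separation R' R f I J \<longleftrightarrow>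
     finite R' \<and> finite R \<and> f ` R' = R \<and> card R' = card R + 1 \<and>
     monomial_ideal R' J \<and>
     natural_map f ` J = I \<and>
     (\<exists>r1 \<in> R'. \<exists>r2 \<in> R'. r1 \<noteq> r2 \<and> f r1 = f r2 \<and>
        (\<exists>g. minimal_generator R' J g \<and> r1 \<in> vars g) \<and>
        (\<exists>g. minimal_generator R' J g \<and> r2 \<in> vars g) \<and>
        regular_element (poly_ring R' Quot J) (J +>\<^bsub>poly_ring R'\<^esub> (var r1 - var r2)))"

text \<open>HOL cannot quantify over all finite sets \<open>R'\<close> at once, so the type of their elements is a
  parameter; a statement of inseparability should leave it an arbitrary type variable.\<close>

definition separable :: "'s itself \<Rightarrow> 'r set \<Rightarrow> ('r, 'k::field) mpoly set \<Rightarrow> bool" where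
  "separable _ R I \<longleftrightarrow> (\<exists>(R' :: 's set) f J. separation R' R f I J)"

definition inseparable :: "'s itself \<Rightarrow> 'r set \<Rightarrow> ('r, 'k::field) mpoly set \<Rightarrow> bool" where
  "inseparable T R I \<longleftrightarrow> \<not> separable T R I"

text \<open>A poset is a carrier set with an order relation on it.\<close>

definition isotone_maps :: "'q set \<Rightarrow> 'q rel \<Rightarrow> 'p set \<Rightarrow> 'p rel \<Rightarrow> ('q \<Rightarrow> 'p) set" where
  "isotone_maps Q rQ P rP =
     {\<phi> \<in> Q \<rightarrow>\<^sub>E P. monotone_on Q (\<lambda>a b. (a, b) \<in> rQ) (\<lambda>a b. (a, b) \<in> rP) \<phi>}"

definition letterplace_generators ::
    "'q set \<Rightarrow> 'q rel \<Rightarrow> 'p set \<Rightarrow> 'p rel \<Rightarrow> ('q \<times> 'p, 'k::field) mpoly set" where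
  "letterplace_generators Q rQ P rP =
     (\<lambda>\<phi>. \<Prod>q \<in> Q. var (q, \<phi> q)) ` isotone_maps Q rQ P rP"


lemma vars_plus: "vars (p + q) \<subseteq> vars p \<union> vars q"
  using keys_add[of p q] by (auto simp: vars_def)

lemma vars_times: "vars (p * q) \<subseteq> vars p \<union> vars q"
proof
  fix x assume "x \<in> vars (p * q)"
  then obtain m where m: "m \<in> Poly_Mapping.keys (p * q)" "x \<in> Poly_Mapping.keys m"
    by (auto simp: vars_def)
  then obtain a b where "m = a + b" "a \<in> Poly_Mapping.keys p" "b \<in> Poly_Mapping.keys q"
    using keys_mult[of p q] by blast
  then show "x \<in> vars p \<union> vars q"
    using m(2) keys_add[of a b] by (auto simp: vars_def)
qed

lemma cring_poly_ring: "cring (poly_ring A :: ('a, 'k::field) mpoly ring)"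
proof (rule cringI)
  show "abelian_group (poly_ring A :: ('a, 'k) mpoly ring)"
  proof (rule abelian_groupI)
    fix p :: "('a, 'k) mpoly" assume "p \<in> carrier (poly_ring A)"
    then have "- p \<in> carrier (poly_ring A)"
      by (auto simp: poly_ring_def vars_def in_keys_iff)
    then show "\<exists>y \<in> carrier (poly_ring A). y \<oplus>\<^bsub>poly_ring A\<^esub> p = \<zero>\<^bsub>poly_ring A\<^esub>"
      by (intro bexI[of _ "- p"]) (auto simp: poly_ring_def)
  next
    fix p q :: "('a, 'k) mpoly"
    assume "p \<in> carrier (poly_ring A)" "q \<in> carrier (poly_ring A)"
    then show "p \<oplus>\<^bsub>poly_ring A\<^esub> q \<in> carrier (poly_ring A)"
      using vars_plus[of p q] by (auto simp: poly_ring_def)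
  qed (auto simp: poly_ring_def vars_def add_ac)
  show "Group.comm_monoid (poly_ring A :: ('a, 'k) mpoly ring)"
  proof (rule comm_monoidI)
    fix p q :: "('a, 'k) mpoly"
    assume "p \<in> carrier (poly_ring A)" "q \<in> carrier (poly_ring A)"
    then show "p \<otimes>\<^bsub>poly_ring A\<^esub> q \<in> carrier (poly_ring A)"
      using vars_times[of p q] by (auto simp: poly_ring_def)
  qed (auto simp: poly_ring_def vars_def mult_ac)
qed (auto simp: poly_ring_def algebra_simps)

end

theory Submission
  imports Defs
begin

text \<open>
  Suppose that \<open>J\<close> separates \<open>I\<close>, that the variables \<open>x\<^sub>1\<close> and \<open>x\<^sub>2\<close> of \<open>J\<close> both map to \<open>x\<^bsub>q,p\<^esub>\<close>,
  and that \<open>x\<^sub>1 m\<^sub>1\<close> and \<open>x\<^sub>2 m\<^sub>2\<close> are minimal generators of \<open>J\<close>. Both \<open>x\<^sub>1 m\<^sub>1 m\<^sub>2\<close> and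
  \<open>x\<^sub>2 m\<^sub>1 m\<^sub>2\<close> lie in \<open>J\<close>, hence so does \<open>(x\<^sub>1 - x\<^sub>2) m\<^sub>1 m\<^sub>2\<close>, and regularity of \<open>x\<^sub>1 - x\<^sub>2\<close>
  puts \<open>m\<^sub>1 m\<^sub>2\<close> into \<open>J\<close>. On the other hand the images of \<open>x\<^sub>1 m\<^sub>1\<close> and \<open>x\<^sub>2 m\<^sub>2\<close> are
  generators of \<open>I\<close>, that is, of the form \<open>\<Prod>q'. x\<^bsub>q',\<phi> q'\<^esub>\<close>. Such a monomial contains exactly one
  variable with first index \<open>q\<close>, which here is \<open>x\<^bsub>q,p\<^esub>\<close>; so the image of \<open>m\<^sub>1 m\<^sub>2\<close> contains no
  variable with first index \<open>q\<close>, although as a monomial of \<open>I\<close> it is divisible by one. What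
  makes this work is that every generator has degree one in the variables with first index \<open>q\<close>;
  \<open>inseparable_if_linear_degree\<close> states the criterion for such degrees.

  What needs an argument is that a minimal generator \<open>u\<close> of \<open>J\<close> maps to a generator of \<open>I\<close> and
  not to a proper multiple of one. If the image of \<open>u\<close> is a multiple of a generator \<open>g\<close>, then
  \<open>g\<close> lifts to a monomial of \<open>J\<close>, and multiplying it up yields a monomial \<open>w\<close> in \<open>J\<close> with the same
  image as \<open>u\<close>. The two differ only in how they distribute the exponent between \<open>x\<^sub>1\<close> and \<open>x\<^sub>2\<close>:
  say \<open>u = c x\<^sub>1\<^sup>n\<close> and \<open>w = c x\<^sub>2\<^sup>n\<close>. If \<open>n > 0\<close>, then \<open>u - w\<close> is \<open>x\<^sub>1 - x\<^sub>2\<close> times a polynomial in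
  which \<open>c x\<^sub>1\<^bsup>n-1\<^esup>\<close> occurs; by regularity that polynomial lies in \<open>J\<close>, and so does this monomial,
  which contradicts the minimality of \<open>u\<close> (\<open>lower_monom_of_regular_difference\<close>,
  \<open>minimal_monom_unique_in_fiber\<close>). Hence \<open>u = w\<close> is a multiple of the lift of \<open>g\<close>, and minimality
  makes them equal.
\<close>

abbreviation monom :: "('a \<Rightarrow>\<^sub>0 nat) \<Rightarrow> ('a, 'k::field) mpoly" where
  "monom m \<equiv> Poly_Mapping.single m 1"

section \<open>Monomial ideals and divisibility of exponent vectors\<close>

lemma vars_monom [simp]: "vars (monom m :: ('a, 'k::field) mpoly) = Poly_Mapping.keys m"
  by (simp add: vars_def)

lemma monom_eq_iff [simp]: "(monom m :: ('a, 'k::field) mpoly) = monom n \<longleftrightarrow> m = n"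
  by (auto dest: arg_cong[where f = Poly_Mapping.keys])

lemma vars_minus_subset: "vars (p - q) \<subseteq> vars p \<union> vars q"
  using keys_diff[of p q] by (auto simp: vars_def)

lemma var_power_eq_monom:
  "(var a :: ('a, 'k::field) mpoly) ^ n = monom (Poly_Mapping.single a n)"
  by (induction n) (simp_all add: var_def mult_single flip: single_add)

lemma prod_monom_eq_monom_sum:
  "(\<Prod>a\<in>A. (monom (e a) :: ('a, 'k::field) mpoly)) = monom (\<Sum>a\<in>A. e a)"
  by (induction A rule: infinite_finite_induct) (simp_all add: mult_single)

lemma sum_single_lookup:
  assumes "finite S" "Poly_Mapping.keys p \<subseteq> S"
  shows "(\<Sum>m\<in>S. Poly_Mapping.single m (Poly_Mapping.lookup p m)) = p"
proof (rule poly_mapping_eqI)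
  fix k
  show "Poly_Mapping.lookup (\<Sum>m\<in>S. Poly_Mapping.single m (Poly_Mapping.lookup p m)) k
    = Poly_Mapping.lookup p k"
    using assms by (auto simp: lookup_sum lookup_single when_def in_keys_iff)
qed

lemma mem_poly_ring [simp]: "p \<in> carrier (poly_ring A) \<longleftrightarrow> vars p \<subseteq> A"
  and poly_ring_ops [simp]: "x \<oplus>\<^bsub>poly_ring A\<^esub> y = x + y" "x \<otimes>\<^bsub>poly_ring A\<^esub> y = x * y"
    "\<zero>\<^bsub>poly_ring A\<^esub> = 0" "\<one>\<^bsub>poly_ring A\<^esub> = 1"
  by (simp_all add: poly_ring_def)

lemma ring_poly_ring: "ring (poly_ring A :: ('a, 'k::field) mpoly ring)"
  using cring_poly_ring by (rule cring.axioms)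

text \<open>Membership in a monomial ideal can be tested term by term. The right-hand side is an ideal
  containing \<open>G\<close>, and each of its elements is the sum of its terms, which are multiples of members
  of \<open>G\<close>.\<close>

lemma genideal_poly_ring_eq:
  fixes G :: "('a, 'k::field) mpoly set"
  assumes G: "G \<subseteq> monomials A"
  shows "genideal (poly_ring A) G =
    {p. vars p \<subseteq> A \<and> (\<forall>m\<in>Poly_Mapping.keys p. \<exists>n d. monom n \<in> G \<and> m = n + d)}"
    (is "_ = ?K")
proof
  interpret R: ring "poly_ring A :: ('a, 'k) mpoly ring" by (rule ring_poly_ring)
  have GA: "G \<subseteq> carrier (poly_ring A)"
    using G by (auto simp: monomials_def)
  have mulK: "x * p \<in> ?K" if "p \<in> ?K" "vars x \<subseteq> A" for p x
  proof -
    have "\<exists>n d. monom n \<in> G \<and> m = n + d" if m: "m \<in> Poly_Mapping.keys (x * p)" for m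
    proof -
      obtain a b where ab: "m = a + b" "b \<in> Poly_Mapping.keys p"
        using keys_mult[of x p] m by blast
      then obtain n d where "monom n \<in> G" "b = n + d" using \<open>p \<in> ?K\<close> by blast
      then show ?thesis using ab by (intro exI[of _ n] exI[of _ "d + a"]) (simp add: add_ac)
    qed
    then show ?thesis using vars_times[of x p] that by blast
  qed
  have "ideal ?K (poly_ring A)"
  proof (rule idealI)
    show "ring (poly_ring A :: ('a, 'k) mpoly ring)" by (rule ring_poly_ring)
    show "subgroup ?K (add_monoid (poly_ring A))"
    proof (rule group.subgroupI[OF R.a_group])
      show "?K \<subseteq> carrier (add_monoid (poly_ring A))" by auto
      show "?K \<noteq> {}" by (auto intro!: exI[of _ 0] simp: vars_def)
    next
      fix p assume p: "p \<in> ?K"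
      have neg: "vars (- p) \<subseteq> A" "Poly_Mapping.keys (- p) = Poly_Mapping.keys p"
        using p by (auto simp: vars_def)
      have "inv\<^bsub>add_monoid (poly_ring A)\<^esub> p = - p"
        using R.minus_equality[of "- p" p] p neg by (simp add: a_inv_def)
      then show "inv\<^bsub>add_monoid (poly_ring A)\<^esub> p \<in> ?K"
        using p neg by auto
    next
      fix p q assume pq: "p \<in> ?K" "q \<in> ?K"
      have "\<exists>n d. monom n \<in> G \<and> m = n + d" if "m \<in> Poly_Mapping.keys (p + q)" for m
        using subsetD[OF keys_add that] pq by (elim UnE) auto
      moreover have "vars (p + q) \<subseteq> A"
        using vars_plus[of p q] pq by auto
      ultimately show "p \<otimes>\<^bsub>add_monoid (poly_ring A)\<^esub> q \<in> ?K"
        by auto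
    qed
  next
    fix p x :: "('a, 'k) mpoly" assume "p \<in> ?K" "x \<in> carrier (poly_ring A)"
    then show "x \<otimes>\<^bsub>poly_ring A\<^esub> p \<in> ?K" "p \<otimes>\<^bsub>poly_ring A\<^esub> x \<in> ?K"
      using mulK[of p x] by (simp_all add: mult.commute)
  qed
  moreover have "G \<subseteq> ?K"
  proof
    fix g assume "g \<in> G"
    then obtain m where "g = monom m" "Poly_Mapping.keys m \<subseteq> A"
      using G by (auto simp: monomials_def)
    moreover from this have "monom m \<in> G \<and> m = m + 0" using \<open>g \<in> G\<close> by simp
    ultimately show "g \<in> ?K" by fastforce
  qed
  ultimately show "genideal (poly_ring A) G \<subseteq> ?K"
    by (rule R.genideal_minimal)
  show "?K \<subseteq> genideal (poly_ring A) G"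
  proof
    fix p assume p: "p \<in> ?K"
    interpret I: ideal "genideal (poly_ring A) G" "poly_ring A"
      using GA by (rule R.genideal_ideal)
    have summand: "Poly_Mapping.single m (Poly_Mapping.lookup p m) \<in> genideal (poly_ring A) G"
      if m: "m \<in> Poly_Mapping.keys p" for m
    proof -
      obtain n d where nd: "monom n \<in> G" "m = n + d" using p m by blast
      have "Poly_Mapping.keys d \<subseteq> Poly_Mapping.keys m"
        by (auto simp: nd in_keys_iff lookup_add)
      then have "vars (Poly_Mapping.single d (Poly_Mapping.lookup p m)) \<subseteq> A"
        using p m by (auto simp: vars_def split: if_splits)
      moreover have "monom n \<in> genideal (poly_ring A) G"
        using R.genideal_self[OF GA] nd by blast
      ultimately have "Poly_Mapping.single d (Poly_Mapping.lookup p m) * monom n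
          \<in> genideal (poly_ring A) G"
        using I.I_l_closed by simp
      then show ?thesis by (simp add: mult_single nd add.commute)
    qed
    have "(\<Sum>m\<in>S. Poly_Mapping.single m (Poly_Mapping.lookup p m)) \<in> genideal (poly_ring A) G"
      if "finite S" "S \<subseteq> Poly_Mapping.keys p" for S
      using that
    proof (induction S rule: finite_induct)
      case empty
      show ?case using I.zero_closed by simp
    next
      case (insert m S)
      then show ?case using I.a_closed[OF summand[of m]] by simp
    qed
    from this[OF finite_keys subset_refl] show "p \<in> genideal (poly_ring A) G"
      by (simp add: sum_single_lookup)
  qed
qed

lemma monom_in_genideal_iff:
  assumes "G \<subseteq> monomials A"
  shows "monom m \<in> genideal (poly_ring A) G \<longleftrightarrow>
    Poly_Mapping.keys m \<subseteq> A \<and> (\<exists>n d. monom n \<in> G \<and> m = n + d)"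
  using assms by (simp add: genideal_poly_ring_eq)

lemma generator_in_genideal:
  assumes "G \<subseteq> monomials A" "g \<in> G"
  shows "g \<in> genideal (poly_ring A) G"
proof -
  interpret R: ring "poly_ring A" by (rule ring_poly_ring)
  have "G \<subseteq> carrier (poly_ring A)"
    using assms(1) by (auto simp: monomials_def)
  then show ?thesis using R.genideal_self assms(2) by blast
qed

lemma monomial_ideal_term:
  assumes "monomial_ideal A J" "p \<in> J" "m \<in> Poly_Mapping.keys p"
  shows "monom m \<in> J"
proof -
  obtain G where G: "G \<subseteq> monomials A" "J = genideal (poly_ring A) G"
    using assms(1) by (auto simp: monomial_ideal_def)
  have "Poly_Mapping.keys m \<subseteq> vars p" using assms(3) by (auto simp: vars_def)
  then show ?thesis
    using assms(2,3) G by (auto simp: genideal_poly_ring_eq)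
qed

lemma monomial_ideal_multiple:
  assumes "monomial_ideal A J" "monom m \<in> J" "Poly_Mapping.keys d \<subseteq> A"
  shows "monom (m + d) \<in> J"
proof -
  obtain G where G: "G \<subseteq> monomials A" "J = genideal (poly_ring A) G"
    using assms(1) by (auto simp: monomial_ideal_def)
  with assms(2) obtain n d' where "monom n \<in> G" "m = n + d'" "Poly_Mapping.keys m \<subseteq> A"
    by (auto simp: monom_in_genideal_iff)
  moreover from this have "m + d = n + (d' + d)" by (simp add: add.assoc)
  moreover have "Poly_Mapping.keys (m + d) \<subseteq> A"
    using keys_add[of m d] assms(3) \<open>Poly_Mapping.keys m \<subseteq> A\<close> by blast
  ultimately show ?thesis
    unfolding G(2) monom_in_genideal_iff[OF G(1)] by blast
qed

lemma ideal_of_monomial_ideal: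
  assumes "monomial_ideal A J"
  shows "ideal J (poly_ring A)"
proof -
  interpret R: ring "poly_ring A" by (rule ring_poly_ring)
  show ?thesis
    using assms unfolding monomial_ideal_def
    by (auto simp: monomials_def intro!: R.genideal_ideal)
qed

lemma monomial_ideal_diff:
  assumes "monomial_ideal A J" "p \<in> J" "q \<in> J"
  shows "p - q \<in> J"
proof -
  interpret I: ideal J "poly_ring A"
    using assms(1) by (rule ideal_of_monomial_ideal)
  have "(- 1) * q \<in> J"
    using I.I_l_closed[OF assms(3), of "- 1"] by (simp add: vars_def)
  then have "p \<oplus>\<^bsub>poly_ring A\<^esub> (- 1) * q \<in> J"
    using additive_subgroup.a_closed[OF I.is_additive_subgroup assms(2)] by blast
  then show ?thesis by simp
qed

text \<open>A member of an irredundant generating set of monomials has no proper divisor in the ideal: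
  the generator below such a divisor would be a different one, and would make this member
  superfluous. Divisibility of monomials is expressed by addition of exponent vectors.\<close>

lemma minimal_generator_obtain:
  fixes J :: "('a, 'k::field) mpoly set"
  assumes "minimal_generator A J g"
  obtains u where "g = monom u" "monom u \<in> J" "Poly_Mapping.keys u \<subseteq> A"
    "\<And>m d. monom m \<in> J \<Longrightarrow> u = m + d \<Longrightarrow> d = 0"
proof -
  obtain G where G: "G \<subseteq> monomials A" "J = genideal (poly_ring A) G" "g \<in> G"
    and min: "\<And>G'. G' \<subset> G \<Longrightarrow> genideal (poly_ring A) G' \<noteq> J"
    using assms by (auto simp: minimal_generator_def minimal_generating_set_def)
  obtain u where u: "g = monom u" "Poly_Mapping.keys u \<subseteq> A"
    using G by (auto simp: monomials_def)
  have uJ: "monom u \<in> J"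
    using generator_in_genideal[OF G(1,3)] G(2) u(1) by simp
  have "d = 0" if m: "monom m \<in> J" and umd: "u = m + d" for m d
  proof (rule ccontr)
    assume d: "d \<noteq> 0"
    obtain n e where n: "monom n \<in> G" "m = n + e"
      using m G(1) unfolding G(2) by (auto simp: monom_in_genideal_iff)
    \<comment> \<open>\<open>n\<close> divides \<open>u\<close> properly, since \<open>u = n + e + d\<close>; so it can replace \<open>u\<close> as a generator.\<close>
    have "n \<noteq> u"
    proof
      assume "n = u"
      then have "u = u + (e + d)" using umd n by (simp add: add.assoc)
      then have "e + d = 0" by simp
      then have "Poly_Mapping.lookup d k = 0" for k
        by (metis add_eq_0_iff_both_eq_0 lookup_add lookup_zero)
      then show False using d by (simp add: poly_mapping_eqI)
    qed
    then have ng: "monom n \<in> G - {g}"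
      using n u by auto
    have eq: "(\<exists>n d. monom n \<in> G - {g} \<and> k = n + d) \<longleftrightarrow> (\<exists>n d. monom n \<in> G \<and> k = n + d)" for k
    proof
      assume "\<exists>n d. monom n \<in> G \<and> k = n + d"
      then obtain n' d' where n': "monom n' \<in> G" "k = n' + d'" by blast
      show "\<exists>n d. monom n \<in> G - {g} \<and> k = n + d"
      proof (cases "n' = u")
        case True
        then have "k = n + (e + d + d')" using n' umd n by (simp add: add.assoc)
        then show ?thesis using ng by blast
      next
        case False
        then have "monom n' \<in> G - {g}"
          using n' u by auto
        then show ?thesis using n' by blast
      qed
    qed blast
    have "G - {g} \<subseteq> monomials A" using G by blast
    then have "genideal (poly_ring A) (G - {g}) = J"
      unfolding G(2) genideal_poly_ring_eq[OF G(1)] using eq by (simp only: genideal_poly_ring_eq)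
    then show False using min[of "G - {g}"] G(3) by blast
  qed
  then show thesis using that u uJ by blast
qed

section \<open>Push-forward of exponent vectors\<close>

text \<open>The effect of \<^const>\<open>natural_map\<close> on monomials, in terms of exponent vectors.\<close>

definition push :: "('a \<Rightarrow> 'b) \<Rightarrow> ('a \<Rightarrow>\<^sub>0 nat) \<Rightarrow> ('b \<Rightarrow>\<^sub>0 nat)" where
  "push f m = (\<Sum>a\<in>Poly_Mapping.keys m. Poly_Mapping.single (f a) (Poly_Mapping.lookup m a))"

lemma push_eq_sum:
  assumes "finite S" "Poly_Mapping.keys m \<subseteq> S"
  shows "push f m = (\<Sum>a\<in>S. Poly_Mapping.single (f a) (Poly_Mapping.lookup m a))"
  unfolding push_def using assms by (intro sum.mono_neutral_left) (auto simp: in_keys_iff)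

lemma push_plus: "push f (m + n) = push f m + push f n"
proof -
  let ?S = "Poly_Mapping.keys m \<union> Poly_Mapping.keys n"
  have "Poly_Mapping.keys (m + n) \<subseteq> ?S" by (rule keys_add)
  then show ?thesis
    by (simp add: push_eq_sum[of ?S] lookup_add single_add sum.distrib)
qed

lemma push_single [simp]: "push f (Poly_Mapping.single a n) = Poly_Mapping.single (f a) n"
  by (simp add: push_eq_sum[of "{a}"])

lemma push_zero [simp]: "push f 0 = 0"
  by (simp add: push_def)

lemma push_sum: "push f (\<Sum>a\<in>S. e a) = (\<Sum>a\<in>S. push f (e a))"
  by (induction S rule: infinite_finite_induct) (simp_all add: push_plus)

lemma lookup_push:
  assumes "finite S" "Poly_Mapping.keys m \<subseteq> S"
  shows "Poly_Mapping.lookup (push f m) b = (\<Sum>a\<in>{a\<in>S. f a = b}. Poly_Mapping.lookup m a)"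
  using assms
  by (simp add: push_eq_sum[of S] lookup_sum lookup_single when_def sum.If_cases Int_def)

lemma keys_push_subset: "Poly_Mapping.keys (push f m) \<subseteq> f ` Poly_Mapping.keys m"
  unfolding push_def by (rule order_trans[OF keys_sum]) auto

lemma push_surj:
  assumes "Poly_Mapping.keys d \<subseteq> f ` S"
  obtains e where "Poly_Mapping.keys e \<subseteq> S" "push f e = d"
proof
  let ?g = "inv_into S f"
  show "Poly_Mapping.keys (push ?g d) \<subseteq> S"
  proof
    fix a assume "a \<in> Poly_Mapping.keys (push ?g d)"
    then obtain b where "b \<in> Poly_Mapping.keys d" "a = ?g b"
      using keys_push_subset[of ?g d] by blast
    then show "a \<in> S" using assms inv_into_into[of b f S] by blast
  qed
  have "push f (push ?g d) =
      (\<Sum>a\<in>Poly_Mapping.keys d. Poly_Mapping.single (f (?g a)) (Poly_Mapping.lookup d a))"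
    unfolding push_def[of ?g] by (simp add: push_sum)
  also have "\<dots> = (\<Sum>a\<in>Poly_Mapping.keys d. Poly_Mapping.single a (Poly_Mapping.lookup d a))"
    using assms by (intro sum.cong) (auto simp: f_inv_into_f subset_iff)
  also have "\<dots> = d" by (simp add: sum_single_lookup)
  finally show "push f (push ?g d) = d" .
qed

lemma natural_map_eq:
  "natural_map f (p :: ('a, 'k::field) mpoly) =
     (\<Sum>m\<in>Poly_Mapping.keys p. Poly_Mapping.single (push f m) (Poly_Mapping.lookup p m))"
  unfolding natural_map_def
  by (simp add: var_power_eq_monom prod_monom_eq_monom_sum mult_single push_def)

lemma natural_map_monom [simp]:
  "natural_map f (monom m :: ('a, 'k::field) mpoly) = monom (push f m)"
  by (simp add: natural_map_eq)

text \<open>Coefficients may cancel when several monomials have the same image, but no monomial arises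
  that is not an image; this is what lets monomials be lifted along \<^const>\<open>natural_map\<close>.\<close>

lemma natural_map_keys:
  assumes "k \<in> Poly_Mapping.keys (natural_map f p)"
  obtains m where "m \<in> Poly_Mapping.keys p" "k = push f m"
proof -
  have "k \<in> (\<Union>m\<in>Poly_Mapping.keys p.
      Poly_Mapping.keys (Poly_Mapping.single (push f m) (Poly_Mapping.lookup p m)))"
    using assms unfolding natural_map_eq by (rule subsetD[OF keys_sum])
  then show thesis using that by (auto split: if_splits)
qed

section \<open>Consequences of regularity\<close>

lemma regular_element_quotientD:
  assumes "ideal J R" "regular_element (R Quot J) (J +>\<^bsub>R\<^esub> a)"
    and "a \<in> carrier R" "p \<in> carrier R" "a \<otimes>\<^bsub>R\<^esub> p \<in> J"
  shows "p \<in> J"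
proof -
  interpret ideal J R by fact
  have "(J +>\<^bsub>R\<^esub> a) \<otimes>\<^bsub>R Quot J\<^esub> (J +>\<^bsub>R\<^esub> p) = J +>\<^bsub>R\<^esub> (a \<otimes>\<^bsub>R\<^esub> p)"
    using assms by (simp add: FactRing_def rcoset_mult_add)
  also have "\<dots> = \<zero>\<^bsub>R Quot J\<^esub>"
    using assms by (simp add: FactRing_def a_coset_join2 additive_subgroup.a_subgroup is_additive_subgroup)
  finally have "J +>\<^bsub>R\<^esub> p = \<zero>\<^bsub>R Quot J\<^esub>"
    using assms by (auto simp: regular_element_def FactRing_def A_RCOSETS_def')
  then show ?thesis
    using a_rcos_self[OF assms(4)] by (simp add: FactRing_def)
qed

text \<open>For \<open>N = n + 1\<close>, write \<open>x\<^sub>r\<^sup>N - x\<^sub>s\<^sup>N = (x\<^sub>r - x\<^sub>s) \<cdot> (x\<^sub>s\<^sup>n + x\<^sub>s\<^bsup>n-1\<^esup> x\<^sub>r + \<dots> + x\<^sub>r\<^sup>n)\<close>. After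
  multiplication by \<open>x\<^sup>c\<close> the left-hand side lies in \<open>J\<close>, hence by regularity so does the second
  factor on the right. Its terms are distinct monomials, so each of them belongs to \<open>J\<close>, in
  particular the last one.\<close>

lemma lower_monom_of_regular_difference:
  fixes J :: "('a, 'k::field) mpoly set"
  assumes J: "monomial_ideal A J"
    and reg: "\<And>p. vars p \<subseteq> A \<Longrightarrow> (var r - var s) * p \<in> J \<Longrightarrow> p \<in> J"
    and rs: "r \<in> A" "s \<in> A" "r \<noteq> s" and c: "Poly_Mapping.keys c \<subseteq> A"
    and 1: "monom (c + Poly_Mapping.single r (Suc n)) \<in> J"
    and 2: "monom (c + Poly_Mapping.single s (Suc n)) \<in> J"
  shows "monom (c + Poly_Mapping.single r n) \<in> J"
proof -
  let ?e = "\<lambda>i. c + (Poly_Mapping.single s (n - i) + Poly_Mapping.single r i)"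
  define j :: "('a, 'k) mpoly" where "j = (\<Sum>i<Suc n. monom (?e i))"
  have "(var r - var s) * (\<Sum>i<Suc n. var s ^ (Suc n - Suc i) * var r ^ i)
      = (var r ^ Suc n - var s ^ Suc n :: ('a, 'k) mpoly)"
    by (rule power_diff_sumr2[symmetric])
  moreover have "j = monom c * (\<Sum>i<Suc n. var s ^ (Suc n - Suc i) * var r ^ i)"
    unfolding j_def by (simp add: sum_distrib_left var_power_eq_monom mult_single del: sum.lessThan_Suc)
  ultimately have "(var r - var s) * j = monom c * (var r ^ Suc n - var s ^ Suc n)"
    by (simp only: mult.left_commute)
  also have "\<dots> = monom (c + Poly_Mapping.single r (Suc n))
      - monom (c + Poly_Mapping.single s (Suc n))"
    by (simp only: var_power_eq_monom right_diff_distrib mult_single mult_1)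
  also have "\<dots> \<in> J"
    using monomial_ideal_diff[OF J 1 2] .
  finally have lj: "(var r - var s) * j \<in> J" .
  have ne: "Poly_Mapping.single s (n - i) + Poly_Mapping.single r i = Poly_Mapping.single r n
      \<longleftrightarrow> i = n" for i
  proof
    assume "Poly_Mapping.single s (n - i) + Poly_Mapping.single r i = Poly_Mapping.single r n"
    then have "Poly_Mapping.lookup (Poly_Mapping.single s (n - i) + Poly_Mapping.single r i) r
        = Poly_Mapping.lookup (Poly_Mapping.single r n) r" by simp
    then show "i = n" using rs by (simp add: lookup_add lookup_single)
  qed simp
  have "vars j \<subseteq> A"
  proof -
    have "Poly_Mapping.keys j \<subseteq> ?e ` {..<Suc n}"
      unfolding j_def by (rule order_trans[OF keys_sum]) auto
    moreover have "Poly_Mapping.keys (?e i) \<subseteq> A" for i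
      using c rs keys_add[of c "Poly_Mapping.single s (n - i) + Poly_Mapping.single r i"]
        keys_add[of "Poly_Mapping.single s (n - i)" "Poly_Mapping.single r i"]
      by (auto split: if_splits)
    ultimately show ?thesis by (fastforce simp: vars_def)
  qed
  then have "j \<in> J" using reg lj by blast
  moreover have "?e n \<in> Poly_Mapping.keys j"
    by (simp add: in_keys_iff j_def lookup_sum lookup_single when_def ne del: sum.lessThan_Suc)
  ultimately show ?thesis using monomial_ideal_term[OF J] by fastforce
qed

text \<open>The hypotheses on the exponents say that \<open>u\<close> and \<open>w\<close> become equal when \<open>x\<^sub>r\<close> and \<open>x\<^sub>s\<close> are
  identified. If \<open>x\<^sub>r\<close> had a larger exponent in \<open>u\<close> than in \<open>w\<close>, then
  \<open>lower_monom_of_regular_difference\<close> would put \<open>u / x\<^sub>r\<close> into \<open>J\<close>, against the minimality of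
  \<open>u\<close>. The same holds for \<open>x\<^sub>s\<close>, and as the sums of the two exponents agree, both
  exponents do.\<close>

lemma minimal_monom_unique_in_fiber:
  fixes J :: "('a, 'k::field) mpoly set"
  assumes J: "monomial_ideal A J"
    and reg: "\<And>p. vars p \<subseteq> A \<Longrightarrow> (var r - var s) * p \<in> J \<Longrightarrow> p \<in> J"
    and rs: "r \<in> A" "s \<in> A" "r \<noteq> s"
    and u: "monom u \<in> J" "Poly_Mapping.keys u \<subseteq> A"
      "\<And>m d. monom m \<in> J \<Longrightarrow> u = m + d \<Longrightarrow> d = 0"
    and w: "monom w \<in> J"
    and outside: "\<And>a. a \<noteq> r \<Longrightarrow> a \<noteq> s \<Longrightarrow> Poly_Mapping.lookup w a = Poly_Mapping.lookup u a"
    and inside: "Poly_Mapping.lookup w r + Poly_Mapping.lookup w s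
      = Poly_Mapping.lookup u r + Poly_Mapping.lookup u s"
  shows "w = u"
proof -
  have not_less: "\<not> Poly_Mapping.lookup w r < Poly_Mapping.lookup u r"
    if reg: "\<And>p. vars p \<subseteq> A \<Longrightarrow> (var r - var s) * p \<in> J \<Longrightarrow> p \<in> J"
      and rs: "r \<in> A" "s \<in> A" "r \<noteq> s"
      and outside: "\<And>a. a \<noteq> r \<Longrightarrow> a \<noteq> s \<Longrightarrow> Poly_Mapping.lookup w a = Poly_Mapping.lookup u a"
      and inside: "Poly_Mapping.lookup w r + Poly_Mapping.lookup w s
        = Poly_Mapping.lookup u r + Poly_Mapping.lookup u s" for r s
  proof
    assume "Poly_Mapping.lookup w r < Poly_Mapping.lookup u r"
    then obtain n where n: "Poly_Mapping.lookup u r = Poly_Mapping.lookup w r + Suc n"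
      by (metis add_Suc_right less_iff_Suc_add)
    define c where "c = u - Poly_Mapping.single r (Suc n)"
    have uc: "u = c + Poly_Mapping.single r (Suc n)"
      by (rule poly_mapping_eqI) (auto simp: c_def lookup_add lookup_minus lookup_single when_def n)
    have wc: "w = c + Poly_Mapping.single s (Suc n)"
    proof (rule poly_mapping_eqI)
      fix a
      show "Poly_Mapping.lookup w a = Poly_Mapping.lookup (c + Poly_Mapping.single s (Suc n)) a"
        using outside[of a] inside n rs
        by (cases "a = r"; cases "a = s") (auto simp: c_def lookup_add lookup_minus lookup_single)
    qed
    have "Poly_Mapping.keys c \<subseteq> A"
      using u(2) by (auto simp: uc in_keys_iff lookup_add)
    then have "monom (c + Poly_Mapping.single r n) \<in> J"
      using lower_monom_of_regular_difference[OF J reg rs] u(1) w unfolding uc wc by blast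
    moreover have "u = (c + Poly_Mapping.single r n) + Poly_Mapping.single r 1"
      by (simp add: uc add.assoc flip: single_add)
    ultimately have "Poly_Mapping.single r (1::nat) = 0" using u(3) by blast
    then have "Poly_Mapping.lookup (Poly_Mapping.single r (1::nat)) r = 0"
      by (simp only: lookup_zero)
    then show False by simp
  qed
  have "p \<in> J" if "vars p \<subseteq> A" "(var s - var r) * p \<in> J" for p
  proof -
    have "((var s - var r) * p - (var s - var r) * p) - (var s - var r) * p \<in> J"
      using that(2) monomial_ideal_diff[OF J] by blast
    then show ?thesis using reg[OF that(1)] by (simp add: algebra_simps)
  qed
  then have "\<not> Poly_Mapping.lookup w s < Poly_Mapping.lookup u s"
    using not_less[of s r] rs outside inside by (simp add: add.commute)
  moreover have "\<not> Poly_Mapping.lookup w r < Poly_Mapping.lookup u r"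
    using not_less[of r s] reg rs outside inside by blast
  ultimately have "Poly_Mapping.lookup w a = Poly_Mapping.lookup u a" for a
    using outside[of a] inside by (cases "a = r"; cases "a = s") auto
  then show ?thesis by (rule poly_mapping_eqI)
qed

section \<open>Inseparability\<close>

text \<open>The degree \<open>\<delta>\<close> may depend on the variable \<open>x\<^sub>r\<close> that is split. If \<open>x\<^sub>1 m\<^sub>1\<close> and
  \<open>x\<^sub>2 m\<^sub>2\<close> are minimal generators of a separation in which \<open>x\<^sub>1\<close> and \<open>x\<^sub>2\<close> map to \<open>x\<^sub>r\<close>, then
  \<open>m\<^sub>1 m\<^sub>2\<close> has an image of degree zero, whereas all monomials of the ideal have positive
  degree.\<close>

lemma inseparable_if_linear_degree:
  fixes G :: "('r, 'k::field) mpoly set"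
  assumes G: "G \<subseteq> monomials R"
    and deg: "\<And>r. r \<in> R \<Longrightarrow> \<exists>\<delta> :: ('r \<Rightarrow>\<^sub>0 nat) \<Rightarrow> nat.
      (\<forall>m n. \<delta> (m + n) = \<delta> m + \<delta> n) \<and> \<delta> (Poly_Mapping.single r 1) = 1 \<and>
      (\<forall>m. monom m \<in> G \<longrightarrow> \<delta> m = 1)"
  shows "inseparable TYPE('s) R (genideal (poly_ring R) G)"
  unfolding inseparable_def separable_def
proof clarify
  fix R' :: "'s set" and f :: "'s \<Rightarrow> 'r" and J
  let ?I = "genideal (poly_ring R) G"
  assume "separation R' R f ?I J"
  then obtain r1 r2 g1 g2 where fin: "finite R'" "finite R" and fR: "f ` R' = R"
    and card: "card R' = card R + 1"
    and J: "monomial_ideal R' J" and img: "natural_map f ` J = ?I"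
    and r: "r1 \<in> R'" "r2 \<in> R'" "r1 \<noteq> r2" "f r1 = f r2"
    and g1: "minimal_generator R' J g1" "r1 \<in> vars g1"
    and g2: "minimal_generator R' J g2" "r2 \<in> vars g2"
    and regq: "regular_element (poly_ring R' Quot J) (J +>\<^bsub>poly_ring R'\<^esub> (var r1 - var r2))"
    unfolding separation_def by blast
  have "vars (var r1 - var r2 :: ('s, 'k) mpoly) \<subseteq> R'"
    using vars_minus_subset[of "var r1" "var r2 :: ('s, 'k) mpoly"] r by (auto simp: var_def)
  then have reg: "p \<in> J" if "vars p \<subseteq> R'" "(var r1 - var r2) * p \<in> J" for p
    using regular_element_quotientD[OF ideal_of_monomial_ideal[OF J] regq] that by simp
  have "f ` (R' - {r2}) = R"
  proof -
    have "f a \<in> f ` (R' - {r2})" if "a \<in> R'" for a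
      using that r by (cases "a = r2") (auto intro: rev_image_eqI[of r1])
    then show ?thesis using fR by blast
  qed
  then have inj: "inj_on f (R' - {r2})"
    using fin card r by (intro eq_card_imp_inj_on) auto
  have collapse: "a = b" if "a \<in> R'" "b \<in> R'" "f a = f b" "a \<noteq> r2" "b \<noteq> r2" for a b
    using inj_onD[OF inj that(3)] that by blast
  have fiber: "{a \<in> R'. f a = f r1} = {r1, r2}"
  proof -
    have "a = r1 \<or> a = r2" if "a \<in> R'" "f a = f r1" for a
      using collapse[of a r1] that r by blast
    then show ?thesis using r by auto
  qed
  have fiber': "{b \<in> R'. f b = f a} = {a}" if a: "a \<in> R'" "a \<noteq> r1" "a \<noteq> r2" for a
  proof -
    have "b = a" if "b \<in> R'" "f b = f a" for b
      using collapse[of b a] collapse[of r1 a] that a r by (cases "b = r2") auto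
    then show ?thesis using a by auto
  qed

  \<comment> \<open>A minimal generator of \<open>J\<close> maps to one of the given generators. Here \<open>m\<close> is the lift of a
    generator \<open>n\<close> dividing the image of \<open>u\<close>, and \<open>w\<close> a multiple of \<open>m\<close> with the same image as
    \<open>u\<close>.\<close>
  have image_in_G: "monom (push f u) \<in> G"
    if uJ: "monom u \<in> J" and uR: "Poly_Mapping.keys u \<subseteq> R'"
      and umin: "\<And>m d. monom m \<in> J \<Longrightarrow> u = m + d \<Longrightarrow> d = 0" for u
  proof -
    have "monom (push f u) \<in> ?I"
      using imageI[OF uJ, of "natural_map f"] by (simp add: img)
    then obtain n d where n: "monom n \<in> G" "push f u = n + d"
      using G by (auto simp: monom_in_genideal_iff)
    have "monom n \<in> ?I"
      using generator_in_genideal[OF G n(1)] .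
    then obtain v where v: "v \<in> J" "natural_map f v = monom n"
      unfolding img[symmetric] by force
    then obtain m where m: "m \<in> Poly_Mapping.keys v" "n = push f m"
      using natural_map_keys[of n f v] by auto
    then have mJ: "monom m \<in> J" using monomial_ideal_term[OF J] v by blast
    have "Poly_Mapping.keys d \<subseteq> Poly_Mapping.keys (push f u)"
      by (auto simp: n in_keys_iff lookup_add)
    then have "Poly_Mapping.keys d \<subseteq> f ` R'"
      using keys_push_subset[of f u] uR by blast
    then obtain e where e: "Poly_Mapping.keys e \<subseteq> R'" "push f e = d" by (rule push_surj)
    define w where "w = m + e"
    have wJ: "monom w \<in> J" unfolding w_def by (rule monomial_ideal_multiple[OF J mJ e(1)])
    then have wR: "Poly_Mapping.keys w \<subseteq> R'"
      using ideal.Icarr[OF ideal_of_monomial_ideal[OF J]] by fastforce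
    have push_eq: "push f w = push f u" by (simp add: w_def push_plus e m n)
    then have sums: "(\<Sum>a\<in>{a\<in>R'. f a = b}. Poly_Mapping.lookup w a)
        = (\<Sum>a\<in>{a\<in>R'. f a = b}. Poly_Mapping.lookup u a)" for b
      using lookup_push[OF fin(1) wR, of f b] lookup_push[OF fin(1) uR, of f b] by simp
    have "w = u"
    proof (rule minimal_monom_unique_in_fiber[OF J reg r(1-3) uJ uR umin wJ])
      show "Poly_Mapping.lookup w a = Poly_Mapping.lookup u a" if "a \<noteq> r1" "a \<noteq> r2" for a
      proof (cases "a \<in> R'")
        case True
        then show ?thesis using sums[of "f a"] fiber'[OF True that] by simp
      next
        case False
        then show ?thesis using wR uR by (metis in_keys_iff subsetD)
      qed
      show "Poly_Mapping.lookup w r1 + Poly_Mapping.lookup w r2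
          = Poly_Mapping.lookup u r1 + Poly_Mapping.lookup u r2"
        using sums[of "f r1"] r(3) by (simp add: fiber)
    qed
    then have "e = 0" using umin mJ unfolding w_def by blast
    then have "d = 0" using e by simp
    then show ?thesis using n by simp
  qed

  obtain u1 where u1: "g1 = monom u1" "monom u1 \<in> J" "Poly_Mapping.keys u1 \<subseteq> R'"
    "\<And>m d. monom m \<in> J \<Longrightarrow> u1 = m + d \<Longrightarrow> d = 0"
    using g1(1) by (rule minimal_generator_obtain) blast
  obtain u2 where u2: "g2 = monom u2" "monom u2 \<in> J" "Poly_Mapping.keys u2 \<subseteq> R'"
    "\<And>m d. monom m \<in> J \<Longrightarrow> u2 = m + d \<Longrightarrow> d = 0"
    using g2(1) by (rule minimal_generator_obtain) blast
  have split: "u = (u - Poly_Mapping.single a 1) + Poly_Mapping.single a 1"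
    if "a \<in> Poly_Mapping.keys u" for u :: "'s \<Rightarrow>\<^sub>0 nat" and a
    using that
    by (intro poly_mapping_eqI) (auto simp: lookup_add lookup_minus lookup_single when_def in_keys_iff)
  \<comment> \<open>The product of \<open>v1\<close> and \<open>v2\<close> lies in \<open>J\<close> because its multiples by \<open>x\<^bsub>r1\<^esub>\<close> and \<open>x\<^bsub>r2\<^esub>\<close> do.\<close>
  obtain v1 where v1: "u1 = v1 + Poly_Mapping.single r1 1"
    using split[of r1 u1] g1(2) u1(1) by auto
  obtain v2 where v2: "u2 = v2 + Poly_Mapping.single r2 1"
    using split[of r2 u2] g2(2) u2(1) by auto
  have v12: "Poly_Mapping.keys v1 \<subseteq> R'" "Poly_Mapping.keys v2 \<subseteq> R'"
    using u1(3) u2(3) by (auto simp: v1 v2 in_keys_iff lookup_add)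
  have "var r1 * monom (v1 + v2) = (monom (u1 + v2) :: ('s, 'k) mpoly)"
    "var r2 * monom (v1 + v2) = (monom (u2 + v1) :: ('s, 'k) mpoly)"
    by (simp_all add: var_def mult_single v1 v2 add_ac)
  then have "var r1 * monom (v1 + v2) \<in> J" "var r2 * monom (v1 + v2) \<in> J"
    using monomial_ideal_multiple[OF J u1(2) v12(2)] monomial_ideal_multiple[OF J u2(2) v12(1)]
    by simp_all
  then have "(var r1 - var r2) * monom (v1 + v2) \<in> J"
    using monomial_ideal_diff[OF J] by (simp add: left_diff_distrib)
  moreover have "Poly_Mapping.keys (v1 + v2) \<subseteq> R'"
    using keys_add[of v1 v2] v12 by blast
  ultimately have "monom (v1 + v2) \<in> J"
    using reg[of "monom (v1 + v2)"] by simp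
  then have "natural_map f (monom (v1 + v2)) \<in> ?I"
    unfolding img[symmetric] by (rule imageI)
  then have "monom (push f (v1 + v2)) \<in> ?I" by simp
  then obtain n d where n: "monom n \<in> G" "push f (v1 + v2) = n + d"
    using G by (auto simp: monom_in_genideal_iff)
  obtain \<delta> :: "('r \<Rightarrow>\<^sub>0 nat) \<Rightarrow> nat" where add: "\<And>m n. \<delta> (m + n) = \<delta> m + \<delta> n"
    and one: "\<delta> (Poly_Mapping.single (f r1) 1) = 1"
    and dG: "\<And>m. monom m \<in> G \<Longrightarrow> \<delta> m = 1"
    using deg[of "f r1"] fR r by blast
  have "\<delta> (push f u1) = 1" "\<delta> (push f u2) = 1"
    using dG image_in_G u1 u2 by blast+
  then have "\<delta> (push f v1) = 0" "\<delta> (push f v2) = 0"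
    using one r(4) by (simp_all add: v1 v2 push_plus add)
  then have "\<delta> (n + d) = 0" by (simp flip: n(2) add: push_plus add)
  then show False using dG[OF n(1)] by (simp add: add)
qed

theorem lemma2p8:
  fixes Q :: "'q set" and rQ :: "'q rel"
    and P :: "'p set" and rP :: "'p rel"
    and G I :: "('q \<times> 'p, 'k::field) mpoly set"
  assumes "finite P" and "partial_order_on P rP"
    and "finite Q" and "partial_order_on Q rQ"
    and "G \<subseteq> letterplace_generators Q rQ P rP"
    and "I = genideal (poly_ring (Q \<times> P)) G"
  shows "inseparable TYPE('s) (Q \<times> P) I"
proof -
  have gen: "\<exists>\<phi>\<in>Q \<rightarrow> P. g = monom (\<Sum>q\<in>Q. Poly_Mapping.single (q, \<phi> q) 1)"
    if g: "g \<in> G" for g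
  proof -
    obtain \<phi> where "\<phi> \<in> Q \<rightarrow> P" "g = (\<Prod>q\<in>Q. var (q, \<phi> q))"
      using g assms(5) by (auto simp: letterplace_generators_def isotone_maps_def PiE_def)
    then show ?thesis by (auto simp: var_def prod_monom_eq_monom_sum)
  qed
  show ?thesis
    unfolding assms(6)
  proof (rule inseparable_if_linear_degree)
    show "G \<subseteq> monomials (Q \<times> P)"
    proof
      fix g assume "g \<in> G"
      then obtain \<phi> where \<phi>: "\<phi> \<in> Q \<rightarrow> P" "g = monom (\<Sum>q\<in>Q. Poly_Mapping.single (q, \<phi> q) 1)"
        using gen by blast
      have "Poly_Mapping.keys (\<Sum>q\<in>Q. Poly_Mapping.single (q, \<phi> q) (1::nat))
          \<subseteq> (\<Union>q\<in>Q. Poly_Mapping.keys (Poly_Mapping.single (q, \<phi> q) (1::nat)))"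
        by (rule keys_sum)
      also have "\<dots> \<subseteq> Q \<times> P" using \<phi>(1) by auto
      finally show "g \<in> monomials (Q \<times> P)" using \<phi>(2) by (auto simp: monomials_def)
    qed
  next
    fix r assume "r \<in> Q \<times> P"
    then obtain q p where r: "r = (q, p)" "q \<in> Q" "p \<in> P" by blast
    \<comment> \<open>the degree in the variables with first index \<open>q\<close>\<close>
    define \<delta> :: "('q \<times> 'p \<Rightarrow>\<^sub>0 nat) \<Rightarrow> nat"
      where "\<delta> m = (\<Sum>p'\<in>P. Poly_Mapping.lookup m (q, p'))" for m
    have "\<delta> (m + n) = \<delta> m + \<delta> n" for m n
      by (simp add: \<delta>_def lookup_add sum.distrib)
    moreover have "\<delta> (Poly_Mapping.single r 1) = 1"
      using r \<open>finite P\<close> by (simp add: \<delta>_def lookup_single when_def)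
    moreover have "\<delta> m = 1" if m: "monom m \<in> G" for m
    proof -
      obtain \<phi> where \<phi>: "\<phi> \<in> Q \<rightarrow> P"
        "(monom m :: ('q \<times> 'p, 'k) mpoly) = monom (\<Sum>q\<in>Q. Poly_Mapping.single (q, \<phi> q) 1)"
        using gen[OF m] by blast
      then have "m = (\<Sum>q\<in>Q. Poly_Mapping.single (q, \<phi> q) 1)"
        by simp
      then have "\<delta> m = (\<Sum>p'\<in>P. \<Sum>q'\<in>Q. if q' = q then (if p' = \<phi> q then 1 else 0) else 0)"
        by (auto simp: \<delta>_def lookup_sum lookup_single when_def intro!: sum.cong)
      also have "\<dots> = 1"
        using \<phi>(1) r assms(1,3) by (auto simp: Pi_iff)
      finally show ?thesis .
    qed
    ultimately show "\<exists>\<delta> :: ('q \<times> 'p \<Rightarrow>\<^sub>0 nat) \<Rightarrow> nat.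
        (\<forall>m n. \<delta> (m + n) = \<delta> m + \<delta> n) \<and> \<delta> (Poly_Mapping.single r 1) = 1 \<and>
        (\<forall>m. monom m \<in> G \<longrightarrow> \<delta> m = 1)"
      by blast
  qed
qed

end
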